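(* Let $d\ge1$, $\alpha_i\in(1,2)$, $K_i>0$ for $i=1,\dots,d$, let $\Omega=\prod_{i=1}^d(\check a_i,\hat a_i)\subset\mathbb{R}^d$, let $T_f>0$, and let $r:\Omega\times(0,T_f]\to\mathbb{R}$ satisfy $0<\check r\le r(\boldsymbol{x},t)\le\hat r$ for constants $\check r,\hat r$. Let $U(\boldsymbol{x},t)$ be the exact solution of $$r(\boldsymbol{x},t)\frac{\partial U}{\partial t}=\sum_{i=1}^dK_i\frac{\partial^{\alpha_i}U}{\partial|x_i|^{\alpha_i}}+f(\boldsymbol{x},t)\ \text{ in }\Omega\times(0,T_f],\qquad U=0\ \text{ on }\partial\Omega,\qquad U(\boldsymbol{x},0)=\psi(\boldsymbol{x}),$$ assumed regular enough that the discretization is consistent, i.e. there are constants $c_1,c_2>0$, independent of the mesh, such that for all positive integers $M,n_1,\dots,n_d$, all $\boldsymbol{J}\in\mathbb{L}$ and all $m=0,\dots,M-1$, the grid values $U_{\boldsymbol{J}}^m=U(\boldsymbol{x}_{\boldsymbol{J}},t_m)$ satisfy $$r_{\boldsymbol{J}}^{m+\frac12}\frac{U_{\boldsymbol{J}}^{m+1}-U_{\boldsymbol{J}}^m}{\Delta t}=\sum_{i=1}^dK_i\,\delta_{x_i}^{\alpha_i}U_{\boldsymbol{J}}^{m+\frac12}+f_{\boldsymbol{J}}^{m+\frac12}+R_{\boldsymbol{J}}^{m+\frac12}+\hat R_{\boldsymbol{J}}^{m+\frac12},\quad |R_{\boldsymbol{J}}^{m+\frac12}|\le c_1\sum_{i=1}^dh_i^4,\quad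 |\hat R_{\boldsymbol{J}}^{m+\frac12}|\le c_2\Delta t^2.$$ Let $u_{\boldsymbol{J}}^m$ be the solution of the finite difference (CN-4FCD) scheme $$r_{\boldsymbol{J}}^{m+\frac12}\frac{u_{\boldsymbol{J}}^{m+1}-u_{\boldsymbol{J}}^m}{\Delta t}=\sum_{i=1}^dK_i\,\delta_{x_i}^{\alpha_i}u_{\boldsymbol{J}}^{m+\frac12}+f_{\boldsymbol{J}}^{m+\frac12},\qquad \boldsymbol{J}\in\mathbb{L},\ m=0,\dots,M-1,\qquad u_{\boldsymbol{J}}^0=\psi(\boldsymbol{x}_{\boldsymbol{J}}).$$ Then there is a constant $C_1>0$, independent of $\Delta t$ and $h_1,\dots,h_d$, such that for all positive integers $M,n_1,\dots,n_d$ and all $m=0,\dots,M-1$, $$\|\mathbf{u}^{m+1}-\mathbf{U}^{m+1}\|\le C_1\big(\Delta t^2+h_1^4+h_2^4+\cdots+h_d^4\big),$$ where $\mathbf{u}^{m+1}=(u_{\boldsymbol{J}}^{m+1})_{\boldsymbol{J}\in\mathbb{L}}$, $\mathbf{U}^{m+1}=(U_{\boldsymbol{J}}^{m+1})_{\boldsymbol{J}\in\mathbb{L}}$, and $\|\cdot\|$ is the discrete $L^2$-norm.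
   Context: Riesz derivative: $$\frac{\partial^{\alpha_i}u(\boldsymbol{x},t)}{\partial|x_i|^{\alpha_i}}=-\frac{1}{2\cos(\alpha_i\pi/2)\Gamma(2-\alpha_i)}\frac{\partial^2}{\partial x_i^2}\int_{\check a_i}^{\hat a_i}\frac{u(x_1,\dots,x_{i-1},\eta,x_{i+1},\dots,x_d,t)}{|x_i-\eta|^{\alpha_i-1}}\,d\eta.$$ Mesh: for positive integers $M,n_1,\dots,n_d$, $\Delta t=T_f/M$, $t_m=m\Delta t$, $t_{m+\frac12}=(m+\frac12)\Delta t$, $h_i=(\hat a_i-\check a_i)/(n_i+1)$; $\mathbb{L}=\{\boldsymbol{J}=(j_1,\dots,j_d):1\le j_i\le n_i\}$; $\boldsymbol{x}_{\boldsymbol{J}}=(\check a_1+j_1h_1,\dots,\check a_d+j_dh_d)$; $r_{\boldsymbol{J}}^{m+\frac12}=r(\boldsymbol{x}_{\boldsymbol{J}},t_{m+\frac12})$, $f_{\boldsymbol{J}}^{m+\frac12}=f(\boldsymbol{x}_{\boldsymbol{J}},t_{m+\frac12})$. For a grid function, the Crank–Nicolson convention is $v_{\boldsymbol{J}}^{m+\frac12}=\frac12(v_{\boldsymbol{J}}^m+v_{\boldsymbol{J}}^{m+1})$ (for $v=u$ and $v=U$), and grid functions are extended by zero to all multi-indices outside $\mathbb{L}$. Fourth-order fractional centered difference operator (4FCD): $$\delta_{x_i}^{\alpha_i}v_{\boldsymbol{J}}=-\frac{1}{h_i^{\alpha_i}}\sum_{k=-\infty}^{\infty}s_k^{(\alpha_i)}v_{\boldsymbol{J}_i-k},\qquad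 \boldsymbol{J}_i-k=(j_1,\dots,j_{i-1},j_i-k,j_{i+1},\dots,j_d),$$ with $$s_k^{(\alpha)}=\frac{(-1)^k\Gamma(\alpha+1)}{\Gamma(\frac{\alpha}{2}-k+1)\Gamma(\frac{\alpha}{2}+k+1)}\left[1+\frac{\alpha(\alpha+1)(\alpha+2)}{6(\alpha-2k+2)(\alpha+2k+2)}\right];$$ equivalently $\sum_{k\in\mathbb{Z}}s_k^{(\alpha)}e^{\mathbf{i}k\theta}=\left[1+\frac{\alpha}{24}(2-2\cos\theta)\right](2-2\cos\theta)^{\alpha/2}$. Discrete $L^2$-norm: $\|\mathbf{v}\|=\sqrt{\prod_{i=1}^dh_i\sum_{\boldsymbol{J}\in\mathbb{L}}|v_{\boldsymbol{J}}|^2}$. *)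

theory Defs
  imports "HOL-Analysis.Analysis"
begin

text \<open>The dimension \<open>d\<close> is \<open>CARD('d)\<close>. Multi-indices are functions \<open>'d \<Rightarrow> int\<close>, so that
  all integer shifts \<open>J\<^sub>i - k\<close> make sense.\<close>

subsection \<open>Riesz derivative on a box\<close>

definition set_coord :: "real ^ 'd \<Rightarrow> 'd \<Rightarrow> real \<Rightarrow> real ^ 'd" where
  "set_coord x i \<eta> = (\<chi> j. if j = i then \<eta> else x $ j)"

definition riesz_kernel ::
    "real \<Rightarrow> 'd \<Rightarrow> (real ^ 'd \<Rightarrow> real) \<Rightarrow> real ^ 'd \<Rightarrow> real \<Rightarrow> real \<Rightarrow> real" where
  "riesz_kernel \<alpha> i v x \<xi> \<eta> = v (set_coord x i \<eta>) / \<bar>\<xi> - \<eta>\<bar> powr (\<alpha> - 1)"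

text \<open>The integral in the Riesz derivative, as a function of the \<open>i\<close>-th coordinate \<open>\<xi>\<close>
  (it does not depend on \<open>x $ i\<close>).\<close>

definition riesz_integral ::
    "real \<Rightarrow> 'd \<Rightarrow> real ^ 'd \<Rightarrow> real ^ 'd \<Rightarrow> (real ^ 'd \<Rightarrow> real) \<Rightarrow> real ^ 'd \<Rightarrow> real \<Rightarrow> real" where
  "riesz_integral \<alpha> i a b v x \<xi> = integral {a $ i..b $ i} (riesz_kernel \<alpha> i v x \<xi>)"

definition riesz_deriv ::
    "real \<Rightarrow> 'd \<Rightarrow> real ^ 'd \<Rightarrow> real ^ 'd \<Rightarrow> (real ^ 'd \<Rightarrow> real) \<Rightarrow> real ^ 'd \<Rightarrow> real" where
  "riesz_deriv \<alpha> i a b v x =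
     - 1 / (2 * cos (\<alpha> * pi / 2) * Gamma (2 - \<alpha>)) *
     deriv (deriv (riesz_integral \<alpha> i a b v x)) (x $ i)"

text \<open>\<^const>\<open>integral\<close> and \<^const>\<open>deriv\<close> are total functions; the following says that the
  integral and the second derivative in \<open>riesz_deriv\<close> really exist at \<open>x\<close>.\<close>

definition riesz_differentiable ::
    "real \<Rightarrow> 'd \<Rightarrow> real ^ 'd \<Rightarrow> real ^ 'd \<Rightarrow> (real ^ 'd \<Rightarrow> real) \<Rightarrow> real ^ 'd \<Rightarrow> bool" where
  "riesz_differentiable \<alpha> i a b v x \<longleftrightarrow>
     (\<forall>\<^sub>F \<xi> in nhds (x $ i).
        riesz_kernel \<alpha> i v x \<xi> integrable_on {a $ i..b $ i} \<and>
        riesz_integral \<alpha> i a b v x field_differentiable at \<xi>) \<and>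
     deriv (riesz_integral \<alpha> i a b v x) field_differentiable at (x $ i)"

subsection \<open>Mesh\<close>

definition mesh_width :: "real ^ 'd \<Rightarrow> real ^ 'd \<Rightarrow> ('d \<Rightarrow> nat) \<Rightarrow> 'd \<Rightarrow> real" where
  "mesh_width a b n i = (b $ i - a $ i) / (real (n i) + 1)"

definition grid_indices :: "('d \<Rightarrow> nat) \<Rightarrow> ('d \<Rightarrow> int) set" where
  "grid_indices n = {J. \<forall>i. 1 \<le> J i \<and> J i \<le> int (n i)}"

definition grid_point :: "real ^ 'd \<Rightarrow> real ^ 'd \<Rightarrow> ('d \<Rightarrow> nat) \<Rightarrow> ('d \<Rightarrow> int) \<Rightarrow> real ^ 'd" where
  "grid_point a b n J = (\<chi> i. a $ i + real_of_int (J i) * mesh_width a b n i)"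

definition time_step :: "real \<Rightarrow> nat \<Rightarrow> real" where
  "time_step T M = T / real M"

definition time_point :: "real \<Rightarrow> nat \<Rightarrow> nat \<Rightarrow> real" where
  "time_point T M m = real m * time_step T M"

definition time_midpoint :: "real \<Rightarrow> nat \<Rightarrow> nat \<Rightarrow> real" where
  "time_midpoint T M m = (real m + 1 / 2) * time_step T M"

subsection \<open>Grid functions\<close>

definition zero_ext :: "('d \<Rightarrow> nat) \<Rightarrow> (('d \<Rightarrow> int) \<Rightarrow> real) \<Rightarrow> ('d \<Rightarrow> int) \<Rightarrow> real" where
  "zero_ext n v J = (if J \<in> grid_indices n then v J else 0)"

definition cn_avg :: "(nat \<Rightarrow> ('d \<Rightarrow> int) \<Rightarrow> real) \<Rightarrow> nat \<Rightarrow> ('d \<Rightarrow> int) \<Rightarrow> real" where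
  "cn_avg v m J = (v m J + v (Suc m) J) / 2"

definition fcd4_coeff :: "real \<Rightarrow> int \<Rightarrow> real" where
  "fcd4_coeff \<alpha> k =
     ((-1) powi k * Gamma (\<alpha> + 1)) / (Gamma (\<alpha> / 2 - of_int k + 1) * Gamma (\<alpha> / 2 + of_int k + 1)) *
     (1 + (\<alpha> * (\<alpha> + 1) * (\<alpha> + 2)) / (6 * (\<alpha> - 2 * of_int k + 2) * (\<alpha> + 2 * of_int k + 2)))"

definition fcd4 :: "real \<Rightarrow> real \<Rightarrow> 'd \<Rightarrow> (('d \<Rightarrow> int) \<Rightarrow> real) \<Rightarrow> ('d \<Rightarrow> int) \<Rightarrow> real" where
  "fcd4 \<alpha> h i v J = - (1 / h powr \<alpha>) * (\<Sum>\<^sub>\<infinity>k\<in>UNIV. fcd4_coeff \<alpha> k * v (J(i := J i - k)))"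

definition grid_norm ::
    "real ^ 'd \<Rightarrow> real ^ 'd \<Rightarrow> ('d \<Rightarrow> nat) \<Rightarrow> (('d :: finite \<Rightarrow> int) \<Rightarrow> real) \<Rightarrow> real" where
  "grid_norm a b n v = sqrt ((\<Prod>i\<in>UNIV. mesh_width a b n i) * (\<Sum>J\<in>grid_indices n. \<bar>v J\<bar>\<^sup>2))"

text \<open>\<open>\<Sum>\<^sub>i K\<^sub>i \<delta>\<^sub>i v\<close>, with the grid function \<open>v\<close> extended by zero outside the grid.\<close>

definition fcd4_sum ::
    "('d \<Rightarrow> real) \<Rightarrow> ('d \<Rightarrow> real) \<Rightarrow> real ^ 'd \<Rightarrow> real ^ 'd \<Rightarrow> ('d \<Rightarrow> nat) \<Rightarrow>
     (('d :: finite \<Rightarrow> int) \<Rightarrow> real) \<Rightarrow> ('d \<Rightarrow> int) \<Rightarrow> real" where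
  "fcd4_sum \<alpha> K a b n v J =
     (\<Sum>i\<in>UNIV. K i * fcd4 (\<alpha> i) (mesh_width a b n i) i (zero_ext n v) J)"

end

theory Submission imports Defs begin

text \<open>The error \<open>e\<close> satisfies the scheme with a residual of size \<open>O(\<Delta>t\<^sup>2 + \<Sum>\<^sub>i h\<^sub>i\<^sup>4)\<close> in place
  of \<open>f\<close>. Testing with \<open>e\<^sup>m\<^sup>+\<^sup>1 - e\<^sup>m\<close> bounds the growth of the energy \<open>- \<langle>L e, e\<rangle>\<close>, where \<open>L\<close>
  is the (symmetric) discrete operator, by \<open>O(\<Delta>t)\<close> times the squared residual, and the energy
  controls the \<open>L\<^sup>2\<close>-norm by a mesh-independent discrete Poincare inequality.

  For the latter, the coefficients are written as \<open>s\<^sub>k = g\<^sub>k + \<alpha>/24 (2 g\<^sub>k - g\<^sub>k\<^sub>-\<^sub>1 - g\<^sub>k\<^sub>+\<^sub>1)\<close>, with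
  \<open>g\<close> those of the second-order centered difference. As \<open>g\<^sub>k \<le> 0\<close> for \<open>k \<noteq> 0\<close> and
  autocorrelations are maximal at lag 0, the form of \<open>g\<close> is at least the partial sum
  \<open>\<Sum>\<^sub>|\<^sub>k\<^sub>|\<^sub>\<le>\<^sub>n g\<^sub>k\<close> times the squared norm; the second difference contributes the same form applied to
  a difference of grid functions, which is nonnegative. The partial sum has a closed form and is of
  order \<open>n\<close> to the power \<open>- \<alpha>\<close>, which compensates the factor \<open>h\<close> to the power \<open>- \<alpha>\<close>.\<close>

subsection \<open>Coefficients of fractional centered differences\<close>

text \<open>These are the Fourier coefficients of
  \<open>(2 - 2 cos \<theta>) powr (\<alpha> / 2)\<close>; in \<open>fcd4_coeff\<close> they are the
  factor in front of the bracket.\<close>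

definition fcd2_coeff :: "real \<Rightarrow> int \<Rightarrow> real" where
  "fcd2_coeff \<alpha> k =
     ((-1) powi k * Gamma (\<alpha> + 1)) / (Gamma (\<alpha> / 2 - of_int k + 1) * Gamma (\<alpha> / 2 + of_int k + 1))"

lemma fcd2_coeff_minus: "fcd2_coeff \<alpha> (- k) = fcd2_coeff \<alpha> k"
  by (simp add: fcd2_coeff_def power_int_minus_one_minus mult.commute)

lemma fcd4_coeff_minus: "fcd4_coeff \<alpha> (- k) = fcd4_coeff \<alpha> k"
  by (simp add: fcd4_coeff_def power_int_minus_one_minus algebra_simps)

text \<open>Since \<open>\<alpha> / 2\<close> lies strictly between 0 and 1, it is not an integer.
  This keeps the Gamma arguments off the poles, so that the functional equation applies.\<close>

lemma half_add_int_neq_0: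
  assumes "0 < \<alpha>" "\<alpha> < 2"
  shows "\<alpha> / 2 + of_int k \<noteq> (0::real)"
proof
  assume "\<alpha> / 2 + of_int k = 0"
  then have "real_of_int k = - (\<alpha> / 2)" by simp
  then have "real_of_int k < real_of_int 0" "real_of_int (-1) < real_of_int k" using assms by auto
  then have "k < 0" "-1 < k" by linarith+
  then show False by simp
qed

lemma half_add_int_notin_nonpos_Ints:
  assumes "0 < \<alpha>" "\<alpha> < 2"
  shows "\<alpha> / 2 + of_int k \<notin> (\<int>\<^sub>\<le>\<^sub>0 :: real set)"
proof
  assume "\<alpha> / 2 + of_int k \<in> \<int>\<^sub>\<le>\<^sub>0"
  then obtain n where "\<alpha> / 2 + of_int k = - of_nat n" by (elim nonpos_Ints_cases')
  then have "\<alpha> / 2 + of_int (k + int n) = 0" by simp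
  with half_add_int_neq_0[OF assms] show False by blast
qed

text \<open>Both Gamma factors of the denominator change by the functional equation, and the sign
  alternates. Later identities use this recurrence in place of Gamma values.\<close>

lemma fcd2_coeff_Suc:
  assumes "0 < \<alpha>" "\<alpha> < 2"
  shows "(\<alpha> / 2 + of_int k + 1) * fcd2_coeff \<alpha> (k + 1) = - (\<alpha> / 2 - of_int k) * fcd2_coeff \<alpha> k"
proof -
  have n: "\<alpha> / 2 + of_int j \<notin> \<int>\<^sub>\<le>\<^sub>0" "\<alpha> / 2 + of_int j \<noteq> 0" for j
    using half_add_int_notin_nonpos_Ints[OF assms]
      half_add_int_neq_0[OF assms] by auto
  define x where "x = \<alpha> / 2 - of_int k"
  define y where "y = \<alpha> / 2 + of_int k + 1"
  have x: "x \<notin> \<int>\<^sub>\<le>\<^sub>0" "x \<noteq> 0" using n[of "- k"] by (simp_all add: x_def)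
  have y: "y \<notin> \<int>\<^sub>\<le>\<^sub>0" "y \<noteq> 0" using n[of "k + 1"] by (simp_all add: y_def add.assoc)
  have [simp]: "Gamma x \<noteq> 0" "Gamma y \<noteq> 0" using x y by (simp_all add: Gamma_eq_zero_iff)
  have p: "(-1::real) powi (k + 1) = - ((-1) powi k)" by (simp add: power_int_add)
  have "fcd2_coeff \<alpha> k = ((-1) powi k * Gamma (\<alpha> + 1)) / (Gamma (x + 1) * Gamma y)"
    by (simp add: fcd2_coeff_def x_def y_def)
  moreover have "fcd2_coeff \<alpha> (k + 1) = (- ((-1) powi k) * Gamma (\<alpha> + 1)) / (Gamma x * Gamma (y + 1))"
    unfolding fcd2_coeff_def p x_def y_def by (simp add: algebra_simps)
  moreover have "Gamma (x + 1) = x * Gamma x" "Gamma (y + 1) = y * Gamma y"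
    using x y by (simp_all add: Gamma_plus1)
  ultimately have "y * fcd2_coeff \<alpha> (k + 1) = - x * fcd2_coeff \<alpha> k"
    using x y by simp
  then show ?thesis by (simp only: x_def y_def)
qed

text \<open>The symbol of the fourth-order operator is
  \<open>[1 + \<alpha>/24 (2 - 2 cos \<theta>)]\<close> times that of the second-order one; on coefficients the factor
  \<open>2 - 2 cos \<theta>\<close> acts as a negative second difference.\<close>

lemma fcd4_coeff_eq:
  assumes "0 < \<alpha>" "\<alpha> < 2"
  shows "fcd4_coeff \<alpha> k = fcd2_coeff \<alpha> k
    + \<alpha> / 24 * (2 * fcd2_coeff \<alpha> k - fcd2_coeff \<alpha> (k - 1) - fcd2_coeff \<alpha> (k + 1))"
proof -
  define x where "x = \<alpha> / 2 - of_int k + 1"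
  define y where "y = \<alpha> / 2 + of_int k + 1"
  define g where "g = fcd2_coeff \<alpha> k"
  have x: "x \<noteq> 0" using half_add_int_neq_0[OF assms, of "1 - k"] by (simp add: x_def)
  have y: "y \<noteq> 0" using half_add_int_neq_0[OF assms, of "1 + k"] by (simp add: y_def add_ac)
  have al: "\<alpha> = x + y - 2" by (simp add: x_def y_def)
  have "y * fcd2_coeff \<alpha> (k + 1) = - (x - 1) * g"
    using fcd2_coeff_Suc[OF assms, of k] by (simp add: x_def y_def g_def)
  then have 1: "fcd2_coeff \<alpha> (k + 1) = - (x - 1) * g / y" using y by (simp add: field_simps)
  have "(y - 1) * g = - x * fcd2_coeff \<alpha> (k - 1)"
    using fcd2_coeff_Suc[OF assms, of "k - 1"] by (simp add: x_def y_def g_def)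
  then have 2: "fcd2_coeff \<alpha> (k - 1) = - (y - 1) * g / x" using x by (simp add: field_simps)
  have 3: "fcd4_coeff \<alpha> k = g * (1 + (\<alpha> * (\<alpha> + 1) * (\<alpha> + 2)) / (6 * (2 * x) * (2 * y)))"
    by (simp add: fcd4_coeff_def fcd2_coeff_def g_def x_def y_def algebra_simps)
  \<comment> \<open>As \<open>x + y = \<alpha> + 2\<close>, the numerator is \<open>(x + y) * (x + y
    - 1) = 2 * x * y + x * (x - 1) + y * (y - 1)\<close>.\<close>
  have 4: "(\<alpha> + 1) * (\<alpha> + 2) / (x * y) = 2 + (x - 1) / y + (y - 1) / x"
    unfolding al using x y by (simp add: divide_simps) (simp add: algebra_simps)
  have "fcd4_coeff \<alpha> k = g + \<alpha> / 24 * (g * ((\<alpha> + 1) * (\<alpha> + 2) / (x * y)))"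
    unfolding 3 using x y by (simp add: divide_simps) (simp add: algebra_simps)
  then show ?thesis
    unfolding 4 1 2 g_def[symmetric] by (simp add: algebra_simps diff_divide_distrib)
qed

section \<open>Closed form, sign and decay of the partial sums\<close>

lemma sum_symmetric_int_interval_Suc:
  fixes f :: "int \<Rightarrow> 'a::comm_monoid_add"
  shows "(\<Sum>k=- int (Suc n)..int (Suc n). f k)
    = (\<Sum>k=- int n..int n. f k) + (f (int n + 1) + f (- (int n + 1)))"
proof -
  have "{- int (Suc n)..int (Suc n)} = insert (int n + 1) (insert (- (int n + 1)) {- int n..int n})"
    by auto
  moreover have "int n + 1 \<notin> insert (- (int n + 1)) {- int n..int n}" "- (int n + 1) \<notin> {- int n..int n}"
    by auto
  ultimately show ?thesis
    by (simp only: sum.insert finite_insert finite_atLeastAtMost_int not_False_eq_True ac_simps)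
qed

definition fcd2_psum :: "real \<Rightarrow> nat \<Rightarrow> real" where
  "fcd2_psum \<alpha> n = (\<Sum>k=- int n..int n. fcd2_coeff \<alpha> k)"

text \<open>By the recurrence the old sum is
  \<open>- (\<alpha> / 2 + n + 1) / (\<alpha> / 2)\<close> times the next coefficient; the two new
  terms, equal by symmetry, add twice that coefficient.\<close>

lemma fcd2_psum_eq:
  assumes "0 < \<alpha>" "\<alpha> < 2"
  shows "fcd2_psum \<alpha> n = (\<alpha> / 2 - real n) / (\<alpha> / 2) * fcd2_coeff \<alpha> (int n)"
proof (induction n)
  case 0
  show ?case using assms by (simp add: fcd2_psum_def)
next
  case (Suc n)
  have "fcd2_psum \<alpha> (Suc n) = fcd2_psum \<alpha> n + 2 * fcd2_coeff \<alpha> (int n + 1)"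
    unfolding fcd2_psum_def sum_symmetric_int_interval_Suc by (simp only: fcd2_coeff_minus)
  moreover have "(\<alpha> / 2 - real n) * fcd2_coeff \<alpha> (int n)
      = - (\<alpha> / 2 + real n + 1) * fcd2_coeff \<alpha> (int n + 1)"
    using fcd2_coeff_Suc[OF assms, of "int n"] by (simp add: algebra_simps)
  ultimately show ?case using Suc assms by (simp add: field_simps)
qed

text \<open>Two consecutive sums are multiples of the same coefficient, which cancels from their
  ratio. The recursion gives both positivity and the decay rate.\<close>

lemma fcd2_psum_Suc:
  assumes "0 < \<alpha>" "\<alpha> < 2"
  shows "fcd2_psum \<alpha> (Suc n)
    = (real n + 1 - \<alpha> / 2) / (real n + 1 + \<alpha> / 2) * fcd2_psum \<alpha> n"
proof -
  define g where "g = fcd2_coeff \<alpha> (int n + 1)"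
  have "(\<alpha> / 2 - real n) * fcd2_coeff \<alpha> (int n) = - (\<alpha> / 2 + real n + 1) * g"
    using fcd2_coeff_Suc[OF assms, of "int n"] by (simp add: g_def algebra_simps)
  then have 1: "fcd2_psum \<alpha> n = - (real n + 1 + \<alpha> / 2) / (\<alpha> / 2) * g"
    using fcd2_psum_eq[OF assms, of n] assms by (simp add: field_simps)
  have 2: "fcd2_psum \<alpha> (Suc n) = - (real n + 1 - \<alpha> / 2) / (\<alpha> / 2) * g"
    using fcd2_psum_eq[OF assms, of "Suc n"] assms by (simp add: field_simps g_def)
  define d where "d = real n + 1 + \<alpha> / 2"
  have "d \<noteq> 0" using assms by (simp add: d_def)
  then show ?thesis unfolding 1 2 d_def[symmetric] using assms by (simp add: field_simps)
qed

lemma fcd2_psum_pos: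
  assumes "0 < \<alpha>" "\<alpha> < 2"
  shows "0 < fcd2_psum \<alpha> n"
proof (induction n)
  case 0
  show ?case using assms by (simp add: fcd2_psum_def fcd2_coeff_def Gamma_real_pos)
next
  case (Suc n)
  have "0 < (real n + 1 - \<alpha> / 2) / (real n + 1 + \<alpha> / 2)"
    using assms by (intro divide_pos_pos) linarith+
  with Suc show ?case unfolding fcd2_psum_Suc[OF assms] by (rule mult_pos_pos[rotated])
qed

text \<open>The sign is read off \<open>fcd2_psum_eq\<close>: the partial sum is positive, while the
  factor \<open>\<alpha> / 2 - n\<close> is negative for \<open>n \<ge> 1\<close>.\<close>

lemma fcd2_coeff_nonpos:
  assumes "0 < \<alpha>" "\<alpha> < 2" "k \<noteq> 0"
  shows "fcd2_coeff \<alpha> k \<le> 0"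
proof -
  have *: "fcd2_coeff \<alpha> (int n) \<le> 0" if n: "0 < n" for n
  proof -
    have "0 < (\<alpha> / 2 - real n) / (\<alpha> / 2) * fcd2_coeff \<alpha> (int n)"
      using fcd2_psum_pos[OF assms(1,2)] fcd2_psum_eq[OF assms(1,2)] by simp
    moreover have "(\<alpha> / 2 - real n) / (\<alpha> / 2) < 0"
      using assms n by (intro divide_neg_pos) auto
    ultimately show ?thesis by (meson mult_nonpos_nonneg less_le_not_le linear)
  qed
  show ?thesis
  proof (cases "k > 0")
    case True
    then show ?thesis using *[of "nat k"] by simp
  next
    case False
    then show ?thesis using *[of "nat (- k)"] assms(3) by (simp add: fcd2_coeff_minus)
  qed
qed

text \<open>Concavity of \<open>ln\<close> between 1 and \<open>1 + p * x\<close>, with weights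
  \<open>1 - 1 / p\<close> and \<open>1 / p\<close>, whose convex combination is
  \<open>1 + x\<close>.\<close>

lemma Bernoulli_powr_ge:
  fixes x p :: real
  assumes "0 \<le> x" "1 \<le> p"
  shows "1 + p * x \<le> (1 + x) powr p"
proof -
  have "(1 - 1 / p) * ln 1 + 1 / p * ln (1 + p * x)
      \<le> ln ((1 - 1 / p) *\<^sub>R 1 + (1 / p) *\<^sub>R (1 + p * x))"
    using assms by (intro concave_onD[OF ln_concave]) (auto intro: add_pos_nonneg)
  also have "(1 - 1 / p) *\<^sub>R 1 + (1 / p) *\<^sub>R (1 + p * x) = 1 + x"
    using assms by (simp add: field_simps)
  finally have "ln (1 + p * x) / p \<le> ln (1 + x)" by simp
  then have "ln (1 + p * x) \<le> p * ln (1 + x)"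
    using assms by (simp add: divide_le_eq mult.commute)
  moreover have "0 < 1 + p * x" using assms by (intro add_pos_nonneg) auto
  ultimately show ?thesis
    using assms by (simp add: powr_def ln_le_cancel_iff[symmetric] del: ln_le_cancel_iff)
qed

text \<open>By Bernoulli's inequality, \<open>fcd2_psum \<alpha> n * (n + 1 - \<alpha> / 2) powr \<alpha>\<close> is increasing in \<open>n\<close>.\<close>

lemma fcd2_psum_ge:
  assumes "1 \<le> \<alpha>" "\<alpha> < 2"
  shows "fcd2_psum \<alpha> 0 * (1 - \<alpha> / 2) powr \<alpha> / (real n + 1) powr \<alpha> \<le> fcd2_psum \<alpha> n"
proof -
  have al: "0 < \<alpha>" using assms by simp
  have "fcd2_psum \<alpha> 0 * (1 - \<alpha> / 2) powr \<alpha> \<le> fcd2_psum \<alpha> n * (real n + 1 - \<alpha> / 2) powr \<alpha>"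
  proof (induction n)
    case 0
    show ?case by simp
  next
    case (Suc n)
    \<comment> \<open>The shift is chosen so that \<open>y / (y + \<alpha>)\<close> is exactly the
      ratio of consecutive partial sums.\<close>
    define y where "y = real n + 1 - \<alpha> / 2"
    have y: "0 < y" using assms by (simp add: y_def)
    have "1 + \<alpha> * (1 / y) \<le> (1 + 1 / y) powr \<alpha>"
      using Bernoulli_powr_ge[of "1 / y" \<alpha>] y assms by simp
    then have "y powr \<alpha> * (1 + \<alpha> * (1 / y)) \<le> y powr \<alpha> * (1 + 1 / y) powr \<alpha>"
      using y by (intro mult_left_mono) auto
    also have "\<dots> = (y + 1) powr \<alpha>"
      using y by (simp add: powr_mult[symmetric] distrib_left)
    finally have "y powr \<alpha> * ((y + \<alpha>) / y) \<le> (y + 1) powr \<alpha>"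
      using y by (simp add: field_simps)
    then have *: "y powr \<alpha> \<le> y / (y + \<alpha>) * (y + 1) powr \<alpha>"
      using y al by (simp add: field_simps)
    have "fcd2_psum \<alpha> n * y powr \<alpha> \<le> fcd2_psum \<alpha> n * (y / (y + \<alpha>) * (y + 1) powr \<alpha>)"
      using fcd2_psum_pos[OF al assms(2), of n] by (intro mult_left_mono[OF *]) simp
    also have "\<dots> = fcd2_psum \<alpha> (Suc n) * (real (Suc n) + 1 - \<alpha> / 2) powr \<alpha>"
      unfolding fcd2_psum_Suc[OF al assms(2)] by (simp add: y_def algebra_simps)
    finally show ?case using Suc by (simp add: y_def)
  qed
  also have "\<dots> \<le> fcd2_psum \<alpha> n * (real n + 1) powr \<alpha>"
    using fcd2_psum_pos[OF al assms(2), of n] assms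
    by (intro mult_left_mono powr_mono2) auto
  finally show ?thesis by (simp add: divide_le_eq)
qed

text \<open>Away from lag 0 the coefficients are nonpositive, so replacing \<open>A k\<close> by the
  maximal value \<open>A 0\<close> can only lower each term.\<close>

lemma sum_fcd2_coeff_mult_ge:
  assumes "0 < \<alpha>" "\<alpha> < 2" and A: "\<And>k. \<bar>A k\<bar> \<le> A 0"
  shows "fcd2_psum \<alpha> n * A 0 \<le> (\<Sum>k=- int n..int n. fcd2_coeff \<alpha> k * A k)"
  unfolding fcd2_psum_def sum_distrib_right
proof (rule sum_mono)
  fix k
  show "fcd2_coeff \<alpha> k * A 0 \<le> fcd2_coeff \<alpha> k * A k"
  proof (cases "k = 0")
    case False
    then show ?thesis
      using fcd2_coeff_nonpos[OF assms(1,2)] A[of k] by (intro mult_left_mono_neg) auto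
  qed simp
qed

text \<open>Summation by parts moves the second difference from the coefficients to
  \<open>A\<close>. By \<open>D\<close> the resulting sequence is again maximal at 0, so the
  second-order bound applies to both parts.\<close>

lemma sum_fcd4_coeff_mult_ge:
  assumes "0 < \<alpha>" "\<alpha> < 2"
    and A: "\<And>k. \<bar>A k\<bar> \<le> A 0"
    and D: "\<And>k. \<bar>2 * A k - A (k - 1) - A (k + 1)\<bar> \<le> 2 * A 0 - A (- 1) - A 1"
    and supp: "\<And>k. int n \<le> \<bar>k\<bar> \<Longrightarrow> A k = 0"
  shows "fcd2_psum \<alpha> n * A 0 \<le> (\<Sum>k=- int n..int n. fcd4_coeff \<alpha> k * A k)"
proof -
  let ?I = "{- int n..int n}"
  \<comment> \<open>Reindexing leaves one unmatched endpoint term on each side; \<open>supp\<close>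
    includes the endpoints, so both vanish.\<close>
  have up: "(\<Sum>k\<in>?I. fcd2_coeff \<alpha> (k - 1) * A k) = (\<Sum>k\<in>?I. fcd2_coeff \<alpha> k * A (k + 1))"
    by (rule sum.reindex_bij_witness_not_neutral[where
          S' = "{- int n}" and T' = "{int n}" and i = "\<lambda>k. k + 1" and j = "\<lambda>k. k - 1"])
       (auto simp: supp)
  have down: "(\<Sum>k\<in>?I. fcd2_coeff \<alpha> (k + 1) * A k) = (\<Sum>k\<in>?I. fcd2_coeff \<alpha> k * A (k - 1))"
    by (rule sum.reindex_bij_witness_not_neutral[where
          S' = "{int n}" and T' = "{- int n}" and i = "\<lambda>k. k - 1" and j = "\<lambda>k. k + 1"])
       (auto simp: supp)
  have "(\<Sum>k\<in>?I. fcd4_coeff \<alpha> k * A k) = (\<Sum>k\<in>?I. fcd2_coeff \<alpha> k * A k)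
    + \<alpha> / 24 * (2 * (\<Sum>k\<in>?I. fcd2_coeff \<alpha> k * A k) - (\<Sum>k\<in>?I. fcd2_coeff \<alpha> (k - 1) * A k)
       - (\<Sum>k\<in>?I. fcd2_coeff \<alpha> (k + 1) * A k))"
    unfolding fcd4_coeff_eq[OF assms(1,2)] sum_distrib_left sum.distrib[symmetric] sum_subtractf[symmetric]
    by (intro sum.cong refl) (simp add: algebra_simps)
  also have "\<dots> = (\<Sum>k\<in>?I. fcd2_coeff \<alpha> k * A k)
    + \<alpha> / 24 * (\<Sum>k\<in>?I. fcd2_coeff \<alpha> k * (2 * A k - A (k - 1) - A (k + 1)))"
    unfolding up down by (simp add: sum_subtractf sum.distrib sum_distrib_left algebra_simps)
  finally have eq: "(\<Sum>k\<in>?I. fcd4_coeff \<alpha> k * A k) = \<dots>" .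
  \<comment> \<open>At \<open>k = 0\<close> the bound \<open>D\<close> compares the absolute value
    of a quantity with the quantity itself, which forces it to be nonnegative.\<close>
  have "0 \<le> 2 * A 0 - A (0 - 1) - A (0 + 1)" using D[of 0] by simp
  then have "0 \<le> fcd2_psum \<alpha> n * (2 * A 0 - A (0 - 1) - A (0 + 1))"
    using fcd2_psum_pos[OF assms(1,2), of n] by simp
  also have "\<dots> \<le> (\<Sum>k\<in>?I. fcd2_coeff \<alpha> k * (2 * A k - A (k - 1) - A (k + 1)))"
    by (rule sum_fcd2_coeff_mult_ge[OF assms(1,2)]) (use D in simp)
  finally have "0 \<le> \<alpha> / 24 * (\<Sum>k\<in>?I. fcd2_coeff \<alpha> k * (2 * A k - A (k - 1) - A (k + 1)))"
    using assms(1) by simp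
  with sum_fcd2_coeff_mult_ge[OF assms(1,2), of A n] A eq show ?thesis by simp
qed

subsection \<open>Autocorrelation of grid functions\<close>

lemma bij_fun_upd_diff: "bij (\<lambda>J. J(i := J i - (k::int)))"
  by (rule bij_betw_byWitness[where f' = "\<lambda>J. J(i := J i + k)"]) auto

lemma infsum_fun_upd_diff:
  fixes F :: "('d \<Rightarrow> int) \<Rightarrow> real"
  shows "(\<Sum>\<^sub>\<infinity>J. F (J(i := J i - k))) = (\<Sum>\<^sub>\<infinity>J. F J)"
  by (rule infsum_reindex_bij_betw[OF bij_fun_upd_diff])

text \<open>Cross-correlation along axis \<open>i\<close>. Summing over the whole lattice makes
  shifts bijections of the index set, so the shift identities have no boundary terms.\<close>

definition corr :: "'d \<Rightarrow> (('d \<Rightarrow> int) \<Rightarrow> real) \<Rightarrow> (('d \<Rightarrow> int) \<Rightarrow> real) \<Rightarrow> int \<Rightarrow> real" where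
  "corr i V W k = (\<Sum>\<^sub>\<infinity>J. V J * W (J(i := J i - k)))"

lemma corr_minus: "corr i V W (- k) = corr i W V k"
  using infsum_fun_upd_diff[of "\<lambda>J. V J * W (J(i := J i + k))" i k]
  by (simp add: corr_def mult.commute)

lemma corr_shift: "corr i (\<lambda>J. V (J(i := J i - p))) (\<lambda>J. W (J(i := J i - q))) k = corr i V W (k + q - p)"
  using infsum_fun_upd_diff[of "\<lambda>J. V J * W (J(i := J i - (k + q - p)))" i p]
  by (simp add: corr_def algebra_simps)

section \<open>Finitely supported grid functions\<close>

definition finite_supp :: "('a \<Rightarrow> real) \<Rightarrow> bool" where
  "finite_supp V \<longleftrightarrow> finite {x. V x \<noteq> 0}"

lemma finite_supp_zero_ext: "finite (grid_indices n) \<Longrightarrow> finite_supp (zero_ext n v)"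
  unfolding finite_supp_def by (rule finite_subset) (auto simp: zero_ext_def split: if_splits)

lemma finite_supp_shift: "finite_supp V \<Longrightarrow> finite_supp (\<lambda>J. V (J(i := J i - (k::int))))"
  unfolding finite_supp_def
  by (rule finite_subset[of _ "(\<lambda>J. J(i := J i + k)) ` {J. V J \<noteq> 0}"])
     (auto intro!: image_eqI[of _ _ "x(i := x i - k)" for x])

lemma finite_supp_diff: "finite_supp V \<Longrightarrow> finite_supp W \<Longrightarrow> finite_supp (\<lambda>J. V J - W J)"
  unfolding finite_supp_def
  by (rule finite_subset[of _ "{J. V J \<noteq> 0} \<union> {J. W J \<noteq> 0}"]) auto

lemma summable_on_mult_finite_supp: "finite_supp V \<Longrightarrow> (\<lambda>J. V J * W J) summable_on UNIV"
  unfolding finite_supp_def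
  by (intro finite_nonzero_values_imp_summable_on) (auto elim: finite_subset[rotated])

lemma corr_diff_left:
  assumes "finite_supp V" "finite_supp V'"
  shows "corr i (\<lambda>J. V J - V' J) W k = corr i V W k - corr i V' W k"
  using infsum_add[of "\<lambda>J. V J * W (J(i := J i - k))" UNIV "\<lambda>J. - (V' J * W (J(i := J i - k)))"]
  by (simp add: corr_def left_diff_distrib infsum_uminus summable_on_uminus summable_on_mult_finite_supp assms)

lemma corr_diff_right:
  assumes "finite_supp V"
  shows "corr i V (\<lambda>J. W J - W' J) k = corr i V W k - corr i V W' k"
  using infsum_add[of "\<lambda>J. V J * W (J(i := J i - k))" UNIV "\<lambda>J. - (V J * W' (J(i := J i - k)))"]
  by (simp add: corr_def right_diff_distrib infsum_uminus summable_on_uminus summable_on_mult_finite_supp assms)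

text \<open>It suffices to sum \<open>2 * \<bar>x * y\<bar> \<le> x\<^sup>2 + y\<^sup>2\<close>,
  since a shift preserves the sum of squares.\<close>

lemma abs_corr_le:
  assumes V: "finite_supp V"
  shows "\<bar>corr i V V k\<bar> \<le> corr i V V 0"
proof -
  let ?W = "\<lambda>J. V (J(i := J i - k))"
  note W = finite_supp_shift[OF V, of i k]
  have sum_sq: "(\<lambda>J. V J * V J + ?W J * ?W J) summable_on UNIV"
    by (intro summable_on_add summable_on_mult_finite_supp V W)
  have "(\<Sum>\<^sub>\<infinity>J. ?W J * ?W J) = (\<Sum>\<^sub>\<infinity>J. V J * V J)"
    using infsum_fun_upd_diff[of "\<lambda>J. V J * V J"] by simp
  then have eq: "(\<Sum>\<^sub>\<infinity>J. V J * V J + ?W J * ?W J) = 2 * corr i V V 0"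
    by (subst infsum_add) (auto intro: summable_on_mult_finite_supp V W simp: corr_def)
  have am_gm: "2 * (x * y) \<le> x * x + y * y" "- (2 * (x * y)) \<le> x * x + y * y" for x y :: real
    using zero_le_square[of "x - y"] zero_le_square[of "x + y"] by (simp_all add: algebra_simps)
  have "c * corr i V V k \<le> 2 * corr i V V 0" if c: "c = 2 \<or> c = -2" for c :: real
    unfolding eq[symmetric] unfolding corr_def infsum_cmult_right'[symmetric]
    using c by (intro infsum_mono sum_sq summable_on_cmult_right summable_on_mult_finite_supp V)
      (auto simp: am_gm)
  from this[of 2] this[of "-2"] show ?thesis by auto
qed

text \<open>The negative second difference of an autocorrelation is the autocorrelation of
  \<open>V\<close> minus its unit shift, to which \<open>abs_corr_le\<close> applies.\<close>

lemma abs_corr_second_diff_le: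
  fixes i :: 'd
  assumes V: "finite_supp V"
  defines "A \<equiv> corr i V V"
  shows "\<bar>2 * A k - A (k - 1) - A (k + 1)\<bar> \<le> 2 * A 0 - A (- 1) - A 1"
proof -
  \<comment> \<open>The zero shift is included so that \<open>corr_shift\<close> evaluates all four
    terms uniformly.\<close>
  define V' where "V' p = (\<lambda>J. V (J(i := J i - p)))" for p
  have fin: "finite_supp (V' p)" for p
    unfolding V'_def by (rule finite_supp_shift[OF V])
  let ?W = "\<lambda>J. V' 0 J - V' 1 J"
  have shift: "corr i (V' p) (V' q) k = A (k + q - p)" for p q k
    unfolding V'_def A_def by (rule corr_shift)
  have eq: "corr i ?W ?W k = 2 * A k - A (k - 1) - A (k + 1)" for k
    by (simp add: corr_diff_left corr_diff_right fin finite_supp_diff shift)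
  show ?thesis
    using abs_corr_le[OF finite_supp_diff[OF fin fin], of i 0 1 k] unfolding eq by simp
qed

subsection \<open>The difference operator as a quadratic form\<close>

lemma grid_indices_eq_PiE: "grid_indices n = PiE UNIV (\<lambda>i. {1..int (n i)})"
  by (auto simp: grid_indices_def PiE_def Pi_def)

lemma finite_grid_indices: "finite (grid_indices (n :: 'd::finite \<Rightarrow> nat))"
  unfolding grid_indices_eq_PiE by (rule finite_PiE) auto

lemma card_grid_indices: "card (grid_indices (n :: 'd::finite \<Rightarrow> nat)) = (\<Prod>i\<in>UNIV. n i)"
  unfolding grid_indices_eq_PiE by (subst card_PiE) auto

text \<open>Only \<open>n i\<close> grid points lie along axis \<open>i\<close>. This cuts the sums
  down to lags in \<open>{- n i..n i}\<close>, with zeros already at both ends, as the summation by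
  parts requires.\<close>

lemma zero_ext_shift_eq_0:
  assumes "J \<in> grid_indices n" "int (n i) \<le> \<bar>k\<bar>"
  shows "zero_ext n v (J(i := J i - k)) = 0"
proof -
  have "1 \<le> J i" "J i \<le> int (n i)" using assms(1) by (auto simp: grid_indices_def)
  then have "\<not> (1 \<le> J i - k \<and> J i - k \<le> int (n i))" using assms(2) by linarith
  then have "J(i := J i - k) \<notin> grid_indices n" by (auto simp: grid_indices_def dest: spec[of _ i])
  then show ?thesis by (simp add: zero_ext_def)
qed

lemma corr_zero_ext:
  fixes n :: "'d::finite \<Rightarrow> nat"
  shows "corr i (zero_ext n v) W k = (\<Sum>J\<in>grid_indices n. v J * W (J(i := J i - k)))"
  unfolding corr_def infsum_finite[OF finite_grid_indices, symmetric]
  by (rule infsum_cong_neutral) (auto simp: zero_ext_def)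

lemma corr_zero_ext_eq_0:
  fixes n :: "'d::finite \<Rightarrow> nat"
  assumes "int (n i) \<le> \<bar>k\<bar>"
  shows "corr i (zero_ext n v) (zero_ext n w) k = 0"
  unfolding corr_zero_ext by (intro sum.neutral ballI) (simp add: zero_ext_shift_eq_0 assms)

lemma fcd4_zero_ext:
  assumes "J \<in> grid_indices n"
  shows "fcd4 \<alpha> h i (zero_ext n v) J = - (1 / h powr \<alpha>) *
    (\<Sum>k=- int (n i)..int (n i). fcd4_coeff \<alpha> k * zero_ext n v (J(i := J i - k)))"
proof -
  have "(\<Sum>\<^sub>\<infinity>k. fcd4_coeff \<alpha> k * zero_ext n v (J(i := J i - k)))
    = (\<Sum>\<^sub>\<infinity>k\<in>{- int (n i)..int (n i)}. fcd4_coeff \<alpha> k * zero_ext n v (J(i := J i - k)))"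
    by (rule infsum_cong_neutral) (auto intro: zero_ext_shift_eq_0[OF assms])
  then show ?thesis by (simp add: fcd4_def)
qed

text \<open>Interchanging the sums leaves one correlation per lag, which gives the kind of sum
  bounded in \<open>sum_fcd4_coeff_mult_ge\<close>.\<close>

lemma sum_mult_fcd4:
  fixes n :: "'d::finite \<Rightarrow> nat"
  shows "(\<Sum>J\<in>grid_indices n. v J * fcd4 \<alpha> h i (zero_ext n w) J) = - (1 / h powr \<alpha>) *
    (\<Sum>k=- int (n i)..int (n i). fcd4_coeff \<alpha> k * corr i (zero_ext n v) (zero_ext n w) k)"
proof -
  have "(\<Sum>J\<in>grid_indices n. v J * fcd4 \<alpha> h i (zero_ext n w) J)
    = (\<Sum>J\<in>grid_indices n. \<Sum>k=- int (n i)..int (n i).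
        - (1 / h powr \<alpha>) * (fcd4_coeff \<alpha> k * (v J * zero_ext n w (J(i := J i - k)))))"
    by (intro sum.cong refl) (simp add: fcd4_zero_ext sum_distrib_left algebra_simps)
  also have "\<dots> = - (1 / h powr \<alpha>) *
    (\<Sum>k=- int (n i)..int (n i). fcd4_coeff \<alpha> k * corr i (zero_ext n v) (zero_ext n w) k)"
    by (subst sum.swap) (simp add: corr_zero_ext sum_distrib_left)
  finally show ?thesis .
qed

section \<open>Linearity and symmetry of the discrete operator\<close>

lemma zero_ext_lincomb:
  "zero_ext n (\<lambda>I. p * v I + q * w I) J = p * zero_ext n v J + q * zero_ext n w J"
  by (simp add: zero_ext_def)

lemma fcd4_lincomb:
  assumes "J \<in> grid_indices n"
  shows "fcd4 \<alpha> h i (zero_ext n (\<lambda>I. p * v I + q * w I)) J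
    = p * fcd4 \<alpha> h i (zero_ext n v) J + q * fcd4 \<alpha> h i (zero_ext n w) J"
  unfolding fcd4_zero_ext[OF assms] zero_ext_lincomb
  by (simp add: distrib_left sum.distrib sum_distrib_left mult_ac)

lemma fcd4_sum_lincomb:
  fixes n :: "'d::finite \<Rightarrow> nat"
  assumes "J \<in> grid_indices n"
  shows "fcd4_sum \<alpha> K a b n (\<lambda>I. p * v I + q * w I) J
    = p * fcd4_sum \<alpha> K a b n v J + q * fcd4_sum \<alpha> K a b n w J"
  unfolding fcd4_sum_def fcd4_lincomb[OF assms]
  by (simp add: distrib_left sum.distrib sum_distrib_left mult_ac)

lemma sum_mult_fcd4_sum:
  fixes n :: "'d::finite \<Rightarrow> nat"
  shows "(\<Sum>J\<in>grid_indices n. v J * fcd4_sum \<alpha> K a b n w J)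
    = (\<Sum>i\<in>UNIV. K i * (\<Sum>J\<in>grid_indices n.
        v J * fcd4 (\<alpha> i) (mesh_width a b n i) i (zero_ext n w) J))"
  unfolding fcd4_sum_def sum_distrib_left by (subst sum.swap) (simp add: mult_ac)

text \<open>The coefficients are even, and negating the lag swaps the two arguments of the
  correlation.\<close>

lemma sum_mult_fcd4_sum_commute:
  fixes n :: "'d::finite \<Rightarrow> nat"
  shows "(\<Sum>J\<in>grid_indices n. v J * fcd4_sum \<alpha> K a b n w J)
    = (\<Sum>J\<in>grid_indices n. w J * fcd4_sum \<alpha> K a b n v J)"
proof -
  have "(\<Sum>k=- int (n i)..int (n i). fcd4_coeff (\<alpha> i) k * corr i (zero_ext n v) (zero_ext n w) k)
    = (\<Sum>k=- int (n i)..int (n i). fcd4_coeff (\<alpha> i) k * corr i (zero_ext n w) (zero_ext n v) k)" for i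
    by (rule sum.reindex_bij_witness[where i = uminus and j = uminus])
       (auto simp: fcd4_coeff_minus corr_minus)
  then show ?thesis unfolding sum_mult_fcd4_sum sum_mult_fcd4 by simp
qed

text \<open>A lower bound for the smallest eigenvalue of the discrete Riesz operator on an interval of
  length \<open>L\<close>, uniform in the mesh.\<close>

definition fcd4_gap :: "real \<Rightarrow> real \<Rightarrow> real" where
  "fcd4_gap \<alpha> L = fcd2_psum \<alpha> 0 * (1 - \<alpha> / 2) powr \<alpha> / L powr \<alpha>"

lemma fcd4_gap_pos: "1 \<le> \<alpha> \<Longrightarrow> \<alpha> < 2 \<Longrightarrow> 0 < L \<Longrightarrow> 0 < fcd4_gap \<alpha> L"
  unfolding fcd4_gap_def by (intro divide_pos_pos mult_pos_pos fcd2_psum_pos) auto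

text \<open>The factor \<open>1 / h powr \<alpha>\<close> is proportional to
  \<open>(n + 1) powr \<alpha>\<close> and so offsets the decay in \<open>fcd2_psum_ge\<close>; only
  the side length and \<alpha> remain in the constant.\<close>

lemma fcd4_coercive:
  fixes n :: "'d::finite \<Rightarrow> nat"
  assumes "1 \<le> \<alpha>" "\<alpha> < 2" and ab: "a $ i < b $ i"
  shows "fcd4_gap \<alpha> (b $ i - a $ i) * (\<Sum>J\<in>grid_indices n. (v J)\<^sup>2)
    \<le> - (\<Sum>J\<in>grid_indices n. v J * fcd4 \<alpha> (mesh_width a b n i) i (zero_ext n v) J)"
proof -
  let ?h = "mesh_width a b n i" and ?V = "zero_ext n v" and ?L = "b $ i - a $ i"
  let ?c = "fcd2_psum \<alpha> 0 * (1 - \<alpha> / 2) powr \<alpha>"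
  have al: "0 < \<alpha>" using assms by simp
  have V: "finite_supp ?V" by (rule finite_supp_zero_ext[OF finite_grid_indices])
  have A0: "corr i ?V ?V 0 = (\<Sum>J\<in>grid_indices n. (v J)\<^sup>2)"
    unfolding corr_zero_ext by (intro sum.cong) (simp_all add: zero_ext_def power2_eq_square)
  then have nonneg: "0 \<le> corr i ?V ?V 0" by (simp add: sum_nonneg)
  have h: "?h powr \<alpha> = ?L powr \<alpha> / (real (n i) + 1) powr \<alpha>" "0 < ?h powr \<alpha>"
    using ab by (simp_all add: mesh_width_def powr_divide)
  have "fcd4_gap \<alpha> ?L = (1 / ?h powr \<alpha>) * (?c / (real (n i) + 1) powr \<alpha>)"
    unfolding fcd4_gap_def h(1) using ab by simp
  also have "\<dots> \<le> (1 / ?h powr \<alpha>) * fcd2_psum \<alpha> (n i)"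
    by (intro mult_left_mono fcd2_psum_ge assms) simp
  finally have "fcd4_gap \<alpha> ?L * corr i ?V ?V 0
      \<le> (1 / ?h powr \<alpha>) * fcd2_psum \<alpha> (n i) * corr i ?V ?V 0"
    using nonneg by (rule mult_right_mono)
  also have "\<dots> = (1 / ?h powr \<alpha>) * (fcd2_psum \<alpha> (n i) * corr i ?V ?V 0)"
    by simp
  also have "\<dots> \<le> (1 / ?h powr \<alpha>) *
      (\<Sum>k=- int (n i)..int (n i). fcd4_coeff \<alpha> k * corr i ?V ?V k)"
    by (intro mult_left_mono sum_fcd4_coeff_mult_ge al assms abs_corr_le V abs_corr_second_diff_le
          corr_zero_ext_eq_0) simp_all
  also have "\<dots> = - (\<Sum>J\<in>grid_indices n. v J * fcd4 \<alpha> ?h i ?V J)"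
    unfolding sum_mult_fcd4 by simp
  finally show ?thesis unfolding A0 .
qed

text \<open>Every direction controls the same sum of squares, so the directional constants add
  up.\<close>

lemma fcd4_sum_coercive:
  fixes n :: "'d::finite \<Rightarrow> nat"
  assumes "\<And>i. 1 \<le> \<alpha> i" "\<And>i. \<alpha> i < 2" "\<And>i. 0 \<le> K i" "\<And>i. a $ i < b $ i"
  shows "(\<Sum>i\<in>UNIV. K i * fcd4_gap (\<alpha> i) (b $ i - a $ i)) * (\<Sum>J\<in>grid_indices n. (v J)\<^sup>2)
    \<le> - (\<Sum>J\<in>grid_indices n. v J * fcd4_sum \<alpha> K a b n v J)"
  unfolding sum_mult_fcd4_sum sum_distrib_right sum_negf[symmetric]
proof (rule sum_mono)
  fix i
  show "K i * fcd4_gap (\<alpha> i) (b $ i - a $ i) * (\<Sum>J\<in>grid_indices n. (v J)\<^sup>2)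
    \<le> - (K i * (\<Sum>J\<in>grid_indices n. v J * fcd4 (\<alpha> i) (mesh_width a b n i) i (zero_ext n v) J))"
    using mult_left_mono[OF fcd4_coercive[OF assms(1)[of i] assms(2)[of i] assms(4)[of i], where n = n and v = v]
        assms(3)[of i]]
    by (simp add: mult.assoc)
qed

subsection \<open>Energy estimate\<close>

text \<open>The scheme is tested with the time increment \<open>w - v\<close>: the average \<open>(v + w) / 2\<close> would give
  differences of \<open>r\<close>-weighted norms, which do not telescope because \<open>r\<close> depends on time.\<close>

lemma crank_nicolson_energy_step:
  fixes L :: "('a \<Rightarrow> real) \<Rightarrow> 'a \<Rightarrow> real"
  assumes sym: "\<And>v w. (\<Sum>J\<in>G. v J * L w J) = (\<Sum>J\<in>G. w J * L v J)"
    and lin: "\<And>J. J \<in> G \<Longrightarrow> L (\<lambda>I. (v I + w I) / 2) J = (L v J + L w J) / 2"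
    and \<tau>: "0 < \<tau>" and rlo: "0 < rlo"
    and r: "\<And>J. J \<in> G \<Longrightarrow> rlo \<le> r J"
    and \<rho>: "\<And>J. J \<in> G \<Longrightarrow> \<bar>\<rho> J\<bar> \<le> P"
    and eq: "\<And>J. J \<in> G \<Longrightarrow> r J * ((w J - v J) / \<tau>) = L (\<lambda>I. (v I + w I) / 2) J - \<rho> J"
  shows "- (\<Sum>J\<in>G. w J * L w J)
    \<le> - (\<Sum>J\<in>G. v J * L v J) + \<tau> * P\<^sup>2 / (2 * rlo) * real (card G)"
proof -
  have "- (\<tau> * P\<^sup>2 / (4 * rlo)) \<le> (w J - v J) * ((L v J + L w J) / 2)" if J: "J \<in> G" for J
  proof -
    define x where "x = w J - v J"
    have "- (\<tau> * P\<^sup>2 / (4 * rlo)) \<le> rlo * x\<^sup>2 / \<tau> - P * \<bar>x\<bar>"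
    proof -
      \<comment> \<open>Completing the square in \<open>\<bar>x\<bar>\<close> is the source of the
        constant \<open>\<tau> * P\<^sup>2 / (4 * rlo)\<close>.\<close>
      have "0 \<le> (2 * rlo * \<bar>x\<bar> - \<tau> * P)\<^sup>2 / (4 * rlo * \<tau>)" using \<tau> rlo by simp
      also have "\<dots> = rlo * \<bar>x\<bar>\<^sup>2 / \<tau> - P * \<bar>x\<bar> + \<tau> * P\<^sup>2 / (4 * rlo)"
        using \<tau> rlo by (simp add: power2_diff power_mult_distrib field_simps power2_eq_square)
      finally show ?thesis by simp
    qed
    also have "\<dots> \<le> r J * x\<^sup>2 / \<tau> + \<rho> J * x"
    proof -
      have "\<bar>\<rho> J * x\<bar> \<le> P * \<bar>x\<bar>" unfolding abs_mult by (intro mult_right_mono \<rho> J) simp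
      moreover have "rlo * x\<^sup>2 / \<tau> \<le> r J * x\<^sup>2 / \<tau>"
        using \<tau> by (intro divide_right_mono mult_right_mono r J) auto
      ultimately show ?thesis by linarith
    qed
    also have "\<dots> = x * (r J * (x / \<tau>) + \<rho> J)"
      by (simp add: power2_eq_square algebra_simps)
    also have "r J * (x / \<tau>) + \<rho> J = (L v J + L w J) / 2"
      using eq[OF J] lin[OF J] by (simp add: x_def)
    finally show ?thesis by (simp add: x_def)
  qed
  then have "(\<Sum>J\<in>G. - (\<tau> * P\<^sup>2 / (4 * rlo))) \<le> (\<Sum>J\<in>G. (w J - v J) * ((L v J + L w J) / 2))"
    by (rule sum_mono)
  also have "\<dots> = ((\<Sum>J\<in>G. w J * L v J) - (\<Sum>J\<in>G. v J * L w J)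
      + (\<Sum>J\<in>G. w J * L w J) - (\<Sum>J\<in>G. v J * L v J)) / 2"
    unfolding sum_subtractf[symmetric] sum.distrib[symmetric] sum_divide_distrib
    by (intro sum.cong refl) (simp add: algebra_simps add_divide_distrib diff_divide_distrib)
  \<comment> \<open>Symmetry cancels the mixed terms and leaves a difference of energies, which
    telescopes in time.\<close>
  also have "\<dots> = ((\<Sum>J\<in>G. w J * L w J) - (\<Sum>J\<in>G. v J * L v J)) / 2"
    using sym[of w v] by simp
  finally show ?thesis by (simp add: field_simps)
qed

text \<open>In each direction \<open>h * n \<le> h * (n + 1) = b - a\<close>. This absorbs the
  number of grid points, which enters by summing the pointwise residual bound.\<close>

lemma prod_mesh_width_mult_card_le:
  fixes n :: "'d::finite \<Rightarrow> nat"
  assumes "\<And>i. a $ i < b $ i"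
  shows "(\<Prod>i\<in>UNIV. mesh_width a b n i) * real (card (grid_indices n))
    \<le> (\<Prod>i\<in>UNIV. b $ i - a $ i)"
  unfolding card_grid_indices of_nat_prod prod.distrib[symmetric]
proof (rule prod_mono)
  fix i
  have "0 < b $ i - a $ i" using assms by simp
  then show "0 \<le> mesh_width a b n i * real (n i) \<and> mesh_width a b n i * real (n i) \<le> b $ i - a $ i"
    by (simp add: mesh_width_def divide_le_eq)
qed

text \<open>The bounds on \<open>r\<close> and the initial condition are available only in the open
  box.\<close>

lemma grid_point_in_box:
  assumes "\<And>i. a $ i < b $ i" "J \<in> grid_indices n"
  shows "grid_point a b n J \<in> box a b"
  unfolding mem_box_cart
proof
  fix i
  have "1 \<le> J i" "J i \<le> int (n i)" using assms(2) by (auto simp: grid_indices_def)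
  then have J: "0 < real_of_int (J i)" "real_of_int (J i) < real (n i) + 1" by linarith+
  have L: "0 < b $ i - a $ i" using assms(1) by simp
  then have h: "0 < mesh_width a b n i" by (simp add: mesh_width_def)
  have "real_of_int (J i) * mesh_width a b n i < (real (n i) + 1) * mesh_width a b n i"
    using J h by simp
  also have "\<dots> = b $ i - a $ i" by (simp add: mesh_width_def)
  finally show "a $ i < grid_point a b n J $ i \<and> grid_point a b n J $ i < b $ i"
    using J h by (simp add: grid_point_def)
qed

theorem theorem2p2:
  fixes \<alpha> K :: "'d::finite \<Rightarrow> real"
    and a b :: "real ^ 'd"
    and T rlo rhi c1 c2 :: real
    and r f U :: "real ^ 'd \<Rightarrow> real \<Rightarrow> real"
    and \<psi> :: "real ^ 'd \<Rightarrow> real"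
  assumes \<alpha>: "\<And>i. 1 < \<alpha> i" "\<And>i. \<alpha> i < 2"
    and K: "\<And>i. 0 < K i"
    and ab: "\<And>i. a $ i < b $ i"
    and T: "0 < T"
    and rlo: "0 < rlo"
    and r: "\<And>x t. x \<in> box a b \<Longrightarrow> t \<in> {0<..T} \<Longrightarrow> rlo \<le> r x t \<and> r x t \<le> rhi"
    and pde: "\<And>x t. x \<in> box a b \<Longrightarrow> t \<in> {0<..T} \<Longrightarrow>
       (\<forall>i. riesz_differentiable (\<alpha> i) i a b (\<lambda>y. U y t) x) \<and>
       (\<exists>Ut. (U x has_real_derivative Ut) (at t within {0<..T}) \<and>
          r x t * Ut = (\<Sum>i\<in>UNIV. K i * riesz_deriv (\<alpha> i) i a b (\<lambda>y. U y t) x) + f x t)"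
    and boundary: "\<And>x t. x \<in> frontier (box a b) \<Longrightarrow> t \<in> {0<..T} \<Longrightarrow> U x t = 0"
    and initial: "\<And>x. x \<in> box a b \<Longrightarrow> U x 0 = \<psi> x"
    and c: "0 < c1" "0 < c2"
    and consistency: "\<And>M n J m. 0 < M \<Longrightarrow> (\<forall>i. 0 < n i) \<Longrightarrow> J \<in> grid_indices n \<Longrightarrow> m < M \<Longrightarrow>
       \<exists>R R'.
         r (grid_point a b n J) (time_midpoint T M m) *
           ((U (grid_point a b n J) (time_point T M (Suc m)) - U (grid_point a b n J) (time_point T M m))
             / time_step T M)
         = fcd4_sum \<alpha> K a b n (cn_avg (\<lambda>l I. U (grid_point a b n I) (time_point T M l)) m) J
           + f (grid_point a b n J) (time_midpoint T M m) + R + R' \<and>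
         \<bar>R\<bar> \<le> c1 * (\<Sum>i\<in>UNIV. mesh_width a b n i ^ 4) \<and>
         \<bar>R'\<bar> \<le> c2 * time_step T M ^ 2"
  shows "\<exists>C1>0. \<forall>M n. \<forall>u :: nat \<Rightarrow> ('d \<Rightarrow> int) \<Rightarrow> real.
     0 < M \<longrightarrow> (\<forall>i. 0 < n i) \<longrightarrow>
     (\<forall>J\<in>grid_indices n. u 0 J = \<psi> (grid_point a b n J)) \<longrightarrow>
     (\<forall>m<M. \<forall>J\<in>grid_indices n.
        r (grid_point a b n J) (time_midpoint T M m) * ((u (Suc m) J - u m J) / time_step T M)
        = fcd4_sum \<alpha> K a b n (cn_avg u m) J + f (grid_point a b n J) (time_midpoint T M m)) \<longrightarrow>
     (\<forall>m<M. grid_norm a b n (\<lambda>J. u (Suc m) J - U (grid_point a b n J) (time_point T M (Suc m)))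
        \<le> C1 * (time_step T M ^ 2 + (\<Sum>i\<in>UNIV. mesh_width a b n i ^ 4)))"
proof -
  define \<kappa> where "\<kappa> = (\<Sum>i\<in>UNIV. K i * fcd4_gap (\<alpha> i) (b $ i - a $ i))"
  define vol where "vol = (\<Prod>i\<in>UNIV. b $ i - a $ i)"
  \<comment> \<open>The root collects volume, total time, the lower bound of \<open>r\<close> and
    the coercivity constant; \<open>max c1 c2\<close> absorbs both residual constants.\<close>
  define C1 where "C1 = sqrt (vol * T / (2 * rlo * \<kappa>)) * max c1 c2"
  have \<kappa>: "0 < \<kappa>"
    unfolding \<kappa>_def
    by (intro sum_pos mult_pos_pos K fcd4_gap_pos) (use \<alpha> ab in \<open>auto intro: less_imp_le\<close>)
  have vol: "0 < vol" unfolding vol_def using ab by (intro prod_pos) simp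
  have "0 < C1" unfolding C1_def using vol T rlo \<kappa> c by (intro mult_pos_pos) auto
  moreover have "grid_norm a b n (\<lambda>J. u (Suc m) J - U (grid_point a b n J) (time_point T M (Suc m)))
      \<le> C1 * (time_step T M ^ 2 + (\<Sum>i\<in>UNIV. mesh_width a b n i ^ 4))"
    if M: "0 < M" and n: "\<forall>i. 0 < n i"
      and init: "\<forall>J\<in>grid_indices n. u 0 J = \<psi> (grid_point a b n J)"
      and scheme: "\<forall>m<M. \<forall>J\<in>grid_indices n.
        r (grid_point a b n J) (time_midpoint T M m) * ((u (Suc m) J - u m J) / time_step T M)
        = fcd4_sum \<alpha> K a b n (cn_avg u m) J + f (grid_point a b n J) (time_midpoint T M m)"
      and m: "m < M" for M n m and u :: "nat \<Rightarrow> ('d \<Rightarrow> int) \<Rightarrow> real"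
  proof -
    define \<tau> where "\<tau> = time_step T M"
    define G where "G = grid_indices n"
    define L where "L = fcd4_sum \<alpha> K a b n"
    define x where "x = grid_point a b n"
    define UU where "UU = (\<lambda>l I. U (x I) (time_point T M l))"
    define e where "e l J = u l J - UU l J" for l J
    define h4 where "h4 = (\<Sum>i\<in>UNIV. mesh_width a b n i ^ 4)"
    define P where "P = c1 * h4 + c2 * \<tau>\<^sup>2"
    define H where "H = (\<Prod>i\<in>UNIV. mesh_width a b n i)"
    have \<tau>: "0 < \<tau>" "real M * \<tau> = T" using T M by (simp_all add: \<tau>_def time_step_def)
    have x: "x J \<in> box a b" if "J \<in> G" for J
      using that grid_point_in_box[OF ab] unfolding x_def G_def by blast
    have h4: "0 \<le> h4" unfolding h4_def by (intro sum_nonneg) simp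
    have H: "0 \<le> H"
      unfolding H_def mesh_width_def using ab by (intro prod_nonneg) (simp add: less_imp_le)
    have lin: "L (\<lambda>I. p * v I + q * w I) J = p * L v J + q * L w J" if "J \<in> G" for p q v w J
      using that unfolding L_def G_def by (rule fcd4_sum_lincomb)
    have avg: "L (\<lambda>I. (v I + w I) / 2) J = (L v J + L w J) / 2" if "J \<in> G" for v w J
      using lin[OF that, of "1 / 2" v "1 / 2" w] by (simp add: add_divide_distrib)
    \<comment> \<open>The bounds on \<open>r\<close> are needed at the half steps, and
      \<open>l + 1 / 2 \<le> M\<close> for \<open>l < M\<close>.\<close>
    have mid: "time_midpoint T M l \<in> {0<..T}" if l: "l < M" for l
    proof -
      have "0 < (real l + 1 / 2) * \<tau>" using \<tau> by (intro mult_pos_pos) auto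
      moreover have "(real l + 1 / 2) * \<tau> \<le> real M * \<tau>" using \<tau> l by (intro mult_right_mono) auto
      ultimately show ?thesis using \<tau> by (simp add: time_midpoint_def \<tau>_def)
    qed
    have step: "- (\<Sum>J\<in>G. e (Suc l) J * L (e (Suc l)) J)
        \<le> - (\<Sum>J\<in>G. e l J * L (e l) J) + \<tau> * P\<^sup>2 / (2 * rlo) * real (card G)" if l: "l < M" for l
    proof -
      \<comment> \<open>The residual is defined so that the error satisfies the perturbed scheme by
        construction; consistency then identifies it as \<open>R + R'\<close>.\<close>
      define \<rho> where "\<rho> J = L (\<lambda>I. (e l I + e (Suc l) I) / 2) J
        - r (x J) (time_midpoint T M l) * ((e (Suc l) J - e l J) / \<tau>)" for J
      have \<rho>: "\<bar>\<rho> J\<bar> \<le> P" if J: "J \<in> G" for J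
      proof -
        from consistency[OF M n J[unfolded G_def] l]
        obtain R R' where R: "\<bar>R\<bar> \<le> c1 * h4" "\<bar>R'\<bar> \<le> c2 * \<tau>\<^sup>2"
          and Ueq: "r (x J) (time_midpoint T M l) * ((UU (Suc l) J - UU l J) / \<tau>)
            = L (cn_avg UU l) J + f (x J) (time_midpoint T M l) + R + R'"
          unfolding L_def UU_def \<tau>_def x_def h4_def by blast
        have ueq: "r (x J) (time_midpoint T M l) * ((u (Suc l) J - u l J) / \<tau>)
            = L (cn_avg u l) J + f (x J) (time_midpoint T M l)"
          using scheme l J unfolding L_def \<tau>_def x_def G_def by blast
        have "(\<lambda>I. (e l I + e (Suc l) I) / 2) = (\<lambda>I. 1 * cn_avg u l I + (-1) * cn_avg UU l I)"
          by (rule ext) (simp add: e_def cn_avg_def field_simps)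
        then have "L (\<lambda>I. (e l I + e (Suc l) I) / 2) J = L (cn_avg u l) J - L (cn_avg UU l) J"
          using lin[OF J, of 1 "cn_avg u l" "-1" "cn_avg UU l"] by simp
        moreover have "r (x J) (time_midpoint T M l) * ((e (Suc l) J - e l J) / \<tau>)
          = r (x J) (time_midpoint T M l) * ((u (Suc l) J - u l J) / \<tau>)
            - r (x J) (time_midpoint T M l) * ((UU (Suc l) J - UU l J) / \<tau>)"
          by (simp add: e_def diff_divide_distrib right_diff_distrib)
        ultimately have "\<rho> J = R + R'" unfolding \<rho>_def ueq Ueq by simp
        with R show ?thesis unfolding P_def by linarith
      qed
      show ?thesis
        by (rule crank_nicolson_energy_step[where r = "\<lambda>J. r (x J) (time_midpoint T M l)" and \<rho> = \<rho>])
           (use r x mid[OF l] \<rho> \<tau> rlo avg in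
             \<open>auto simp: \<rho>_def L_def G_def intro: sum_mult_fcd4_sum_commute\<close>)
    qed
    \<comment> \<open>Both grid functions start from the values of \<open>\<psi>\<close>, so the
      energy starts at zero and only the residual feeds it.\<close>
    have "e 0 J = 0" if "J \<in> G" for J
      using init initial[OF x[OF that]] that
      by (simp add: e_def UU_def G_def x_def time_point_def)
    then have e0: "(\<Sum>J\<in>G. e 0 J * L (e 0) J) = 0" by simp
    have energy: "- (\<Sum>J\<in>G. e l J * L (e l) J) \<le> real l * (\<tau> * P\<^sup>2 / (2 * rlo) * real (card G))"
      if "l \<le> M" for l
      using that
    proof (induction l)
      case 0
      show ?case using e0 by simp
    next
      case (Suc l)
      then show ?case using step[of l] by (simp add: distrib_right add_divide_distrib)
    qed
    define E where "E = (\<Sum>J\<in>G. (e (Suc m) J)\<^sup>2)"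
    have "\<kappa> * E \<le> - (\<Sum>J\<in>G. e (Suc m) J * L (e (Suc m)) J)"
      unfolding \<kappa>_def E_def G_def L_def
      by (rule fcd4_sum_coercive) (use \<alpha> K ab in \<open>auto intro: less_imp_le\<close>)
    also have "\<dots> \<le> real (Suc m) * (\<tau> * P\<^sup>2 / (2 * rlo) * real (card G))"
      using energy[of "Suc m"] m by simp
    \<comment> \<open>Enlarging \<open>Suc m\<close> to \<open>M\<close> turns the step count times
      \<tau> into \<open>T\<close>, which makes the bound uniform in \<open>m\<close> and in the
      time step.\<close>
    also have "\<dots> \<le> real M * (\<tau> * P\<^sup>2 / (2 * rlo) * real (card G))"
      using m \<tau> rlo by (intro mult_right_mono) auto
    also have "\<dots> = (real M * \<tau>) * (P\<^sup>2 / (2 * rlo) * real (card G))" by simp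
    finally have "E \<le> T / (2 * rlo * \<kappa>) * P\<^sup>2 * real (card G)"
      unfolding \<tau>(2) using \<kappa> rlo by (simp add: field_simps)
    then have "H * E \<le> H * (T / (2 * rlo * \<kappa>) * P\<^sup>2 * real (card G))"
      using H by (rule mult_left_mono)
    also have "\<dots> = T / (2 * rlo * \<kappa>) * P\<^sup>2 * (H * real (card G))" by simp
    also have "\<dots> \<le> T / (2 * rlo * \<kappa>) * P\<^sup>2 * vol"
      using prod_mesh_width_mult_card_le[OF ab, of n] T rlo \<kappa>
      unfolding H_def G_def vol_def by (intro mult_left_mono) auto
    also have "\<dots> = vol * T / (2 * rlo * \<kappa>) * P\<^sup>2" by simp
    finally have "sqrt (H * E) \<le> sqrt (vol * T / (2 * rlo * \<kappa>) * P\<^sup>2)"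
      by (rule real_sqrt_le_mono)
    also have "\<dots> = sqrt (vol * T / (2 * rlo * \<kappa>)) * \<bar>P\<bar>"
      by (simp only: real_sqrt_mult real_sqrt_abs)
    also have "\<dots> \<le> sqrt (vol * T / (2 * rlo * \<kappa>)) * (max c1 c2 * (\<tau>\<^sup>2 + h4))"
    proof (rule mult_left_mono)
      have "c1 * h4 \<le> max c1 c2 * h4" "c2 * \<tau>\<^sup>2 \<le> max c1 c2 * \<tau>\<^sup>2"
        using h4 by (auto intro: mult_right_mono)
      moreover have "0 \<le> P" using c h4 by (simp add: P_def)
      ultimately show "\<bar>P\<bar> \<le> max c1 c2 * (\<tau>\<^sup>2 + h4)" by (simp add: P_def distrib_left)
      show "0 \<le> sqrt (vol * T / (2 * rlo * \<kappa>))" using vol T rlo \<kappa> by simp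
    qed
    finally show ?thesis
      by (simp add: grid_norm_def C1_def H_def E_def G_def e_def UU_def x_def h4_def \<tau>_def mult.assoc)
  qed
  ultimately show ?thesis by blast
qed

end
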